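(* Let $(V,b,m)$ be an infinite, locally finite, connected graph over a non-Archimedean ordered field $\mathbb K$ which is Cauchy complete and has countable cofinality, and let $a\in V$. The following statements are equivalent: (i) $\displaystyle\sum_{r=1}^\infty\frac1{b(\partial B_r(a))}=\infty$. (ii) There is a subsequence of balls $(B_{n_k}(a))_k$ (with $1\le n_1<n_2<\dots$) such that $\lim_{k\to\infty}b(\partial B_{n_k}(a))=0$. (iii) There is a subsequence of balls $(B_{n_k}(a))_k$ (with $1\le n_1<n_2<\dots$) such that $\displaystyle\lim_{k\to\infty}\max_{(x,y)\in\partial B_{n_k}(a)}b(x,y)=0$. If one of these conditions is satisfied, then the graph has null capacity.
   Context: An ordered field $(\mathbb K,\succ)$ is non-Archimedean if there is $\tau\succ0$ with $\tau\prec 1/n$ for all $n\in\mathbb N$. $\mathbb K^+=\{k\in\mathbb K: k\succ0\}$. A sequence $(k_n)$ converges to $k\in\mathbb K$ if for every $c\in\mathbb K^+$ one has $|k_n-k|\preceq c$ for all large $n$, and $k_n\to\infty$ means that for every $c\in\mathbb K$ one has $k_n\succ c$ for all large $n$; a series equals $\infty$ if its partial sums tend to $\infty$. Cauchy complete: every Cauchy sequence converges. Countable cofinality: there is a countable $S\subset\mathbb K$ such that every $k\in\mathbb K$ satisfies $k\preceq s$ for some $s\in S$. A graph $(V,b,m)$ over $\mathbb K$: $V$ is an at most countable set, $m:V\to\mathbb K^+$, and $b:V\times V\to\mathbb K^+\cup\{0\}$ is symmetric with $b(x,x)=0$. Write $x\sim y$ if $b(x,y)\neq0$; locally finite means each vertex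 has finitely many neighbors; connectedness is with respect to paths $x_0\sim x_1\sim\dots\sim x_n$, and $d$ is the combinatorial graph distance. $B_n(a)=\{x\in V: d(a,x)<n\}$. For $W\subseteq V$, $\partial W=W\times(V\setminus W)$, and for finite $W$, $b(\partial W)=\sum_{x\in W,\,y\in V\setminus W}b(x,y)$. Laplacian: $\Delta f(x)=\frac1{m(x)}\sum_{y\in V}(f(x)-f(y))b(x,y)$ for $f:V\to\mathbb K$. For a finite connected $K\subseteq V$ and $a\in K$ there is a unique $v:V\to\mathbb K$ with $\Delta v=0$ on $K\setminus\{a\}$, $v(a)=1$, $v=0$ on $V\setminus K$; put $\mathrm{cap}_K(a)=\Delta v(a)m(a)$ and $\mathrm{cap}_n(a)=\mathrm{cap}_{B_n(a)}(a)$. The graph has null capacity if $\lim_{n\to\infty}\mathrm{cap}_n(a)=0$ for some (equivalently, all) $a\in V$. *)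

theory Defs
  imports Complex_Main "HOL-Library.Countable_Set"
begin

definition non_archimedean :: "'k::linordered_field itself \<Rightarrow> bool" where
  "non_archimedean _ \<longleftrightarrow> (\<exists>\<tau>::'k. 0 < \<tau> \<and> (\<forall>n::nat. 1 \<le> n \<longrightarrow> \<tau> < 1 / of_nat n))"

text \<open>Convergence is with respect to all positive elements of the field itself, not only the
  rational ones.  No topology is imposed on the type.  Divergence to infinity is
  \<open>filterlim s at_top sequentially\<close>; see \<open>filterlim_at_top_dense\<close> for its elementary form.\<close>

definition converges_to :: "(nat \<Rightarrow> 'k::linordered_field) \<Rightarrow> 'k \<Rightarrow> bool" where
  "converges_to s l \<longleftrightarrow> (\<forall>c>0. \<forall>\<^sub>F n in sequentially. \<bar>s n - l\<bar> \<le> c)"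

definition cauchy_seq :: "(nat \<Rightarrow> 'k::linordered_field) \<Rightarrow> bool" where
  "cauchy_seq s \<longleftrightarrow> (\<forall>c>0. \<exists>N. \<forall>i\<ge>N. \<forall>j\<ge>N. \<bar>s i - s j\<bar> \<le> c)"

definition cauchy_complete :: "'k::linordered_field itself \<Rightarrow> bool" where
  "cauchy_complete _ \<longleftrightarrow> (\<forall>s::nat \<Rightarrow> 'k. cauchy_seq s \<longrightarrow> (\<exists>l. converges_to s l))"

definition countable_cofinality :: "'k::linordered_field itself \<Rightarrow> bool" where
  "countable_cofinality _ \<longleftrightarrow> (\<exists>S::'k set. countable S \<and> (\<forall>k. \<exists>s\<in>S. k \<le> s))"

text \<open>The vertex set is a carrier \<open>V\<close> in an arbitrary type; the values of \<open>b\<close> and \<open>m\<close> outside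
  \<open>V\<close> are irrelevant.\<close>

locale weighted_graph =
  fixes V :: "'v set"
    and b :: "'v \<Rightarrow> 'v \<Rightarrow> 'k::linordered_field"
    and m :: "'v \<Rightarrow> 'k"
  assumes countable_vertices: "countable V"
    and m_pos: "x \<in> V \<Longrightarrow> 0 < m x"
    and b_nonneg: "\<lbrakk>x \<in> V; y \<in> V\<rbrakk> \<Longrightarrow> 0 \<le> b x y"
    and b_sym: "\<lbrakk>x \<in> V; y \<in> V\<rbrakk> \<Longrightarrow> b x y = b y x"
    and b_diag: "x \<in> V \<Longrightarrow> b x x = 0"

definition adjacency :: "'v set \<Rightarrow> ('v \<Rightarrow> 'v \<Rightarrow> 'k::linordered_field) \<Rightarrow> ('v \<times> 'v) set" where
  "adjacency V b = {(x, y). x \<in> V \<and> y \<in> V \<and> b x y \<noteq> 0}"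

definition neighbors :: "'v set \<Rightarrow> ('v \<Rightarrow> 'v \<Rightarrow> 'k::linordered_field) \<Rightarrow> 'v \<Rightarrow> 'v set" where
  "neighbors V b x = {y \<in> V. b x y \<noteq> 0}"

definition locally_finite_graph :: "'v set \<Rightarrow> ('v \<Rightarrow> 'v \<Rightarrow> 'k::linordered_field) \<Rightarrow> bool" where
  "locally_finite_graph V b \<longleftrightarrow> (\<forall>x\<in>V. finite (neighbors V b x))"

text \<open>\<open>(x, y) \<in> adjacency V b ^^ n\<close> says that there is a path of \<open>n\<close> edges from \<open>x\<close> to \<open>y\<close>.\<close>

definition connected_graph :: "'v set \<Rightarrow> ('v \<Rightarrow> 'v \<Rightarrow> 'k::linordered_field) \<Rightarrow> bool" where
  "connected_graph V b \<longleftrightarrow> (\<forall>x\<in>V. \<forall>y\<in>V. \<exists>n. (x, y) \<in> adjacency V b ^^ n)"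

definition graph_dist :: "'v set \<Rightarrow> ('v \<Rightarrow> 'v \<Rightarrow> 'k::linordered_field) \<Rightarrow> 'v \<Rightarrow> 'v \<Rightarrow> nat" where
  "graph_dist V b x y = (LEAST n. (x, y) \<in> adjacency V b ^^ n)"

definition graph_ball :: "'v set \<Rightarrow> ('v \<Rightarrow> 'v \<Rightarrow> 'k::linordered_field) \<Rightarrow> 'v \<Rightarrow> nat \<Rightarrow> 'v set" where
  "graph_ball V b a n = {x \<in> V. graph_dist V b a x < n}"

definition edge_boundary :: "'v set \<Rightarrow> 'v set \<Rightarrow> ('v \<times> 'v) set" where
  "edge_boundary V W = W \<times> (V - W)"

text \<open>A sum over an infinite set is \<open>0\<close> by convention in HOL.  The sums below are therefore
  restricted to the pairs with nonzero weight, which are finitely many when the graph is locally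
  finite and \<open>W\<close> is finite; the omitted terms all vanish.\<close>

definition boundary_weight ::
    "'v set \<Rightarrow> ('v \<Rightarrow> 'v \<Rightarrow> 'k::linordered_field) \<Rightarrow> 'v set \<Rightarrow> 'k" where
  "boundary_weight V b W = (\<Sum>(x, y) \<in> {(x, y) \<in> edge_boundary V W. b x y \<noteq> 0}. b x y)"

definition laplacian ::
    "'v set \<Rightarrow> ('v \<Rightarrow> 'v \<Rightarrow> 'k::linordered_field) \<Rightarrow> ('v \<Rightarrow> 'k) \<Rightarrow> ('v \<Rightarrow> 'k) \<Rightarrow> 'v \<Rightarrow> 'k" where
  "laplacian V b m f x = 1 / m x * (\<Sum>y\<in>neighbors V b x. (f x - f y) * b x y)"

text \<open>A function on \<open>V\<close> is represented by a function on the whole type that vanishes outside \<open>V\<close>,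
  so that the potential is unique as a function on the type; hence \<open>v x = 0\<close> is required for all
  \<open>x \<notin> K\<close>.\<close>

definition capacity_potential ::
    "'v set \<Rightarrow> ('v \<Rightarrow> 'v \<Rightarrow> 'k::linordered_field) \<Rightarrow> ('v \<Rightarrow> 'k) \<Rightarrow> 'v set \<Rightarrow> 'v \<Rightarrow> 'v \<Rightarrow> 'k" where
  "capacity_potential V b m K a =
     (THE v. (\<forall>x\<in>K - {a}. laplacian V b m v x = 0) \<and> v a = 1 \<and> (\<forall>x. x \<notin> K \<longrightarrow> v x = 0))"

definition capacity ::
    "'v set \<Rightarrow> ('v \<Rightarrow> 'v \<Rightarrow> 'k::linordered_field) \<Rightarrow> ('v \<Rightarrow> 'k) \<Rightarrow> 'v set \<Rightarrow> 'v \<Rightarrow> 'k" where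
  "capacity V b m K a = laplacian V b m (capacity_potential V b m K a) a * m a"

definition null_capacity ::
    "'v set \<Rightarrow> ('v \<Rightarrow> 'v \<Rightarrow> 'k::linordered_field) \<Rightarrow> ('v \<Rightarrow> 'k) \<Rightarrow> bool" where
  "null_capacity V b m \<longleftrightarrow>
     (\<exists>a\<in>V. converges_to (\<lambda>n. capacity V b m (graph_ball V b a n) a) 0)"

end

theory Submission
  imports Defs
begin

text \<open>
  All natural numbers lie below one field element \<open>1 / \<tau>\<close>.  Hence a series whose terms are bounded
  by some \<open>1 / c\<close> has bounded partial sums, so the series in (i) diverges only if the boundary
  weights come arbitrarily close to \<open>0\<close>; and a boundary weight is at most \<open>1 / \<tau>\<close> times the
  largest weight of a boundary edge.  Countable cofinality serves to extract a sequence.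

  For the capacity let \<open>v\<close> be the potential of \<open>B\<^sub>n(a)\<close>.  By the maximum principle
  \<open>0 \<le> v \<le> 1\<close>, and summing \<open>\<Delta>v\<close> over a smaller ball \<open>B\<^sub>r(a)\<close> shows that the capacity is the flux
  of \<open>v\<close> through \<open>\<partial>B\<^sub>r(a)\<close>, which is at most \<open>b(\<partial>B\<^sub>r(a))\<close>.
\<close>

section \<open>Sequences in non-Archimedean fields\<close>

text \<open>\<open>T\<close> is the reciprocal of an infinitesimal. It later replaces counts that
  vary with the radius: the number of terms of a partial sum and the number of boundary edges of a
  ball.\<close>

lemma non_archimedean_bound:
  assumes "non_archimedean TYPE('k::linordered_field)"
  obtains T :: "'k::linordered_field" where "0 < T" "\<And>n::nat. of_nat n \<le> T"
proof -
  obtain \<tau> :: 'k where \<tau>: "0 < \<tau>" "\<And>n::nat. 1 \<le> n \<Longrightarrow> \<tau> < 1 / of_nat n"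
    using assms unfolding non_archimedean_def by blast
  have "of_nat n \<le> 1 / \<tau>" for n :: nat
  proof (cases "n = 0")
    case False
    then have "\<tau> * of_nat n < 1"
      using \<tau>(2)[of n] by (simp add: field_simps)
    then show ?thesis
      using \<tau>(1) by (simp add: field_simps)
  qed (use \<tau>(1) in simp)
  with \<tau>(1) show thesis
    by (intro that[of "1 / \<tau>"]) auto
qed

lemma countable_cofinality_null_sequence:
  assumes "countable_cofinality TYPE('k::linordered_field)"
  obtains e :: "nat \<Rightarrow> 'k::linordered_field" where "\<And>k. 0 < e k" "converges_to e 0"
proof -
  obtain S :: "'k set" where S: "countable S" "\<And>k. \<exists>s\<in>S. k \<le> s"
    using assms unfolding countable_cofinality_def by blast
  have "S \<noteq> {}"
    using S(2) by blast
  \<comment> \<open>An enumeration of a cofinal set need not tend to infinity. Partial sums of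
    absolute values are nondecreasing, so once \<open>u\<close> passes an element it stays above it;
    the summand \<open>1\<close> keeps \<open>u\<close> positive.\<close>
  define u where "u k = 1 + (\<Sum>i\<le>k. \<bar>from_nat_into S i\<bar>)" for k
  have u_pos: "0 < u k" for k
    unfolding u_def by (simp add: add_pos_nonneg sum_nonneg)
  have "converges_to (\<lambda>k. 1 / u k) 0"
    unfolding converges_to_def
  proof (intro allI impI)
    fix c :: 'k
    assume "0 < c"
    obtain s where s: "s \<in> S" "1 / c \<le> s"
      using S(2) by blast
    then obtain j where j: "from_nat_into S j = s"
      using from_nat_into_surj[OF S(1)] by blast
    have "\<bar>1 / u k - 0\<bar> \<le> c" if "j \<le> k" for k
    proof -
      have "\<bar>s\<bar> \<le> (\<Sum>i\<le>k. \<bar>from_nat_into S i\<bar>)"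
        using member_le_sum[of j "{..k}" "\<lambda>i. \<bar>from_nat_into S i\<bar>"] that j by simp
      then have "1 / c \<le> u k"
        using s(2) unfolding u_def by linarith
      then show ?thesis
        using u_pos[of k] \<open>0 < c\<close> by (simp add: field_simps)
    qed
    then show "\<forall>\<^sub>F k in sequentially. \<bar>1 / u k - 0\<bar> \<le> c"
      using eventually_sequentially by blast
  qed
  with u_pos show thesis
    by (intro that[of "\<lambda>k. 1 / u k"]) auto
qed

lemma converges_to_zero_mono:
  assumes "converges_to t 0" "\<And>k. \<bar>s k\<bar> \<le> \<bar>t k\<bar>"
  shows "converges_to s 0"
  unfolding converges_to_def
proof (intro allI impI)
  fix c :: 'a
  assume "0 < c"
  then have "\<forall>\<^sub>F k in sequentially. \<bar>t k - 0\<bar> \<le> c"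
    using assms(1) unfolding converges_to_def by blast
  then show "\<forall>\<^sub>F k in sequentially. \<bar>s k - 0\<bar> \<le> c"
    by eventually_elim (use assms(2) order_trans in \<open>fastforce\<close>)
qed

lemma converges_to_zero_mult:
  assumes "converges_to s 0" "0 < C"
  shows "converges_to (\<lambda>k. C * s k) 0"
  unfolding converges_to_def
proof (intro allI impI)
  fix c :: 'a
  assume "0 < c"
  then have "\<forall>\<^sub>F k in sequentially. \<bar>s k - 0\<bar> \<le> c / C"
    using assms unfolding converges_to_def by simp
  then show "\<forall>\<^sub>F k in sequentially. \<bar>C * s k - 0\<bar> \<le> c"
    by eventually_elim (use assms(2) in \<open>simp add: abs_mult field_simps\<close>)
qed

lemma null_subsequence:
  fixes s :: "nat \<Rightarrow> 'k::linordered_field"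
  assumes "countable_cofinality TYPE('k)"
    and nonneg: "\<And>r. 0 \<le> s r"
    and small: "\<And>c N. 0 < c \<Longrightarrow> \<exists>r\<ge>N. s r \<le> c"
  shows "\<exists>n. strict_mono n \<and> (\<forall>k. 1 \<le> n k) \<and> converges_to (\<lambda>k. s (n k)) 0"
proof -
  obtain e :: "nat \<Rightarrow> 'k" where e: "\<And>k. 0 < e k" "converges_to e 0"
    using countable_cofinality_null_sequence[OF assms(1)] by blast
  have "\<exists>n. \<forall>k. (1 \<le> n k \<and> s (n k) \<le> e k) \<and> n k < n (Suc k)"
  proof (rule dependent_nat_choice)
    show "\<exists>r. 1 \<le> r \<and> s r \<le> e 0"
      using small[OF e(1)] by blast
    \<comment> \<open>The threshold \<open>Suc r\<close> yields both \<open>r < r'\<close> and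
      \<open>1 \<le> r'\<close>.\<close>
    show "\<exists>r'. (1 \<le> r' \<and> s r' \<le> e (Suc k)) \<and> r < r'" for r k
      using small[OF e(1)[of "Suc k"], of "Suc r"] by (metis Suc_le_D Suc_le_eq Suc_le_mono One_nat_def le0)
  qed
  then obtain n where n: "\<And>k. 1 \<le> n k" "\<And>k. s (n k) \<le> e k" "\<And>k. n k < n (Suc k)"
    by blast
  have "converges_to (\<lambda>k. s (n k)) 0"
    using e(2) by (rule converges_to_zero_mono) (use nonneg n(2) e(1) in \<open>simp add: less_imp_le\<close>)
  with n show ?thesis
    by (auto simp: strict_mono_Suc_iff)
qed

lemma small_if_reciprocals_diverge:
  fixes s :: "nat \<Rightarrow> 'k::linordered_field"
  assumes "non_archimedean TYPE('k)"
    and div: "filterlim (\<lambda>N. \<Sum>r=1..N. 1 / s r) at_top sequentially"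
    and "0 < c"
  shows "\<exists>r\<ge>N. s r \<le> c"
proof (rule ccontr)
  assume "\<not> (\<exists>r\<ge>N. s r \<le> c)"
  then have large: "c < s r" if "N \<le> r" for r
    using that by force
  obtain T :: 'k where T: "0 < T" "\<And>n::nat. of_nat n \<le> T"
    using non_archimedean_bound[OF assms(1)] by blast
  \<comment> \<open>\<open>A\<close> collects the terms up to \<open>N\<close>, where
    \<open>s\<close> is not controlled. Each later term is at most \<open>1 / c\<close>, and their
    number is at most \<open>T\<close>.\<close>
  define A where "A = (\<Sum>r=1..N. 1 / s r)"
  have bound: "(\<Sum>r=1..M. 1 / s r) \<le> A + of_nat (M - N) * (1 / c)" if "N \<le> M" for M
    using that
  proof (induction M rule: dec_induct)
    case (step M)
    have "1 / s (Suc M) \<le> 1 / c"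
      using large[of "Suc M"] step.hyps \<open>0 < c\<close> by (intro divide_left_mono) (auto intro: less_imp_le)
    with step show ?case
      by (simp add: Suc_diff_le algebra_simps)
  qed (simp add: A_def)
  have "\<forall>\<^sub>F M in sequentially. A + T * (1 / c) + 1 \<le> (\<Sum>r=1..M. 1 / s r)"
    using div unfolding filterlim_at_top by blast
  then obtain M0 where M0: "\<And>M. M0 \<le> M \<Longrightarrow> A + T * (1 / c) + 1 \<le> (\<Sum>r=1..M. 1 / s r)"
    unfolding eventually_sequentially by blast
  have "of_nat (max M0 N - N) * (1 / c) \<le> T * (1 / c)"
    by (rule mult_right_mono[OF T(2)]) (use \<open>0 < c\<close> in simp)
  with M0[of "max M0 N"] bound[of "max M0 N"] show False
    by simp
qed

text \<open>One term suffices: since all terms are positive, a single summand of size at least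
  \<open>Z\<close> keeps every later partial sum at least \<open>Z\<close>.\<close>

lemma reciprocals_diverge_if_null_subsequence:
  fixes s :: "nat \<Rightarrow> 'k::linordered_field"
  assumes pos: "\<And>r. 1 \<le> r \<Longrightarrow> 0 < s r"
    and n: "\<And>k. 1 \<le> n k" "converges_to (\<lambda>k. s (n k)) 0"
  shows "filterlim (\<lambda>N. \<Sum>r=1..N. 1 / s r) at_top sequentially"
  unfolding filterlim_at_top
proof
  fix Z :: 'k
  define c where "c = 1 / (\<bar>Z\<bar> + 1)"
  have "0 < c"
    unfolding c_def by (simp add: add_nonneg_pos)
  then have "\<forall>\<^sub>F k in sequentially. \<bar>s (n k)\<bar> \<le> c"
    using n(2) unfolding converges_to_def by simp
  then obtain k where "\<bar>s (n k)\<bar> \<le> c"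
    unfolding eventually_sequentially by blast
  moreover have "0 < s (n k)"
    using pos n(1) by blast
  ultimately have "1 / c \<le> 1 / s (n k)"
    by (intro divide_left_mono) (auto simp: \<open>0 < c\<close>)
  then have Z: "Z \<le> 1 / s (n k)"
    unfolding c_def by simp
  have "Z \<le> (\<Sum>r=1..N. 1 / s r)" if "n k \<le> N" for N
  proof -
    have "1 / s (n k) \<le> (\<Sum>r=1..N. 1 / s r)"
      by (rule member_le_sum) (use that n(1) pos in \<open>auto simp: less_imp_le\<close>)
    with Z show ?thesis
      by simp
  qed
  then show "\<forall>\<^sub>F N in sequentially. Z \<le> (\<Sum>r=1..N. 1 / s r)"
    unfolding eventually_sequentially by blast
qed

section \<open>The maximum principle and the Dirichlet problem\<close>

locale locally_finite_connected_graph = weighted_graph V b m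
  for V :: "'v set" and b :: "'v \<Rightarrow> 'v \<Rightarrow> 'k::linordered_field" and m :: "'v \<Rightarrow> 'k" +
  assumes locally_finite: "locally_finite_graph V b"
    and connected: "connected_graph V b"
begin

lemma finite_neighbors: "x \<in> V \<Longrightarrow> finite (neighbors V b x)"
  using locally_finite unfolding locally_finite_graph_def by blast

text \<open>This is \<open>m x\<close> times the Laplacian. Removing the vertex weight preserves
  harmonicity and lets the contributions of inner edges cancel when summed over a set of
  vertices.\<close>

definition outflow :: "('v \<Rightarrow> 'k) \<Rightarrow> 'v \<Rightarrow> 'k" where
  "outflow f x = (\<Sum>y\<in>neighbors V b x. (f x - f y) * b x y)"

lemma laplacian_eq_outflow: "laplacian V b m f x = outflow f x / m x"
  unfolding laplacian_def outflow_def by simp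

lemma laplacian_eq_0_iff: "x \<in> V \<Longrightarrow> laplacian V b m f x = 0 \<longleftrightarrow> outflow f x = 0"
  using m_pos[of x] by (simp add: laplacian_eq_outflow)

lemma outflow_linear: "outflow (\<lambda>y. f y + t * g y) x = outflow f x + t * outflow g x"
  unfolding outflow_def sum_distrib_left sum.distrib[symmetric]
  by (rule sum.cong) (auto simp: algebra_simps)

lemma outflow_diff: "outflow (\<lambda>y. f y - g y) x = outflow f x - outflow g x"
  using outflow_linear[of f "- 1" g x] by simp

lemma outflow_uminus: "outflow (\<lambda>y. - f y) x = - outflow f x"
  using outflow_linear[of "\<lambda>_. 0" "- 1" f x] by (simp add: outflow_def)

text \<open>Otherwise \<open>M\<close> would be closed under adjacency and, by induction on path
  length, contain every vertex reachable from \<open>x\<close>.\<close>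

lemma exists_crossing_edge:
  assumes "M \<subseteq> V" "x \<in> M" "V - M \<noteq> {}"
  shows "\<exists>p\<in>M. \<exists>q\<in>V - M. b p q \<noteq> 0"
proof (rule ccontr)
  assume *: "\<not> ?thesis"
  have "y \<in> M" if "(x, y) \<in> adjacency V b ^^ n" for n y
    using that
  proof (induction n arbitrary: y)
    case 0
    then show ?case using assms(2) by simp
  next
    case (Suc n)
    then obtain p where "(x, p) \<in> adjacency V b ^^ n" "(p, y) \<in> adjacency V b"
      by auto
    with Suc.IH * show ?case
      unfolding adjacency_def by auto
  qed
  moreover obtain z where "z \<in> V - M"
    using assms(3) by blast
  ultimately show False
    using connected assms unfolding connected_graph_def by blast
qed

text \<open>If \<open>f\<close> exceeded \<open>c\<close> somewhere, its maximum would lie in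
  \<open>U\<close>. At a harmonic maximum point all summands of the outflow are nonnegative with sum
  \<open>0\<close>, so each neighbor attains the maximum too. An edge leaving the set
  \<open>M\<close> of maximum points is therefore impossible.\<close>

lemma maximum_principle:
  assumes U: "finite U" "U \<subseteq> V" "V - U \<noteq> {}"
    and harm: "\<And>x. x \<in> U \<Longrightarrow> outflow f x = 0"
    and bound: "\<And>x. x \<in> V - U \<Longrightarrow> f x \<le> c"
    and "x \<in> V"
  shows "f x \<le> c"
proof (rule ccontr)
  assume "\<not> f x \<le> c"
  then have "c < f x" "x \<in> U"
    using bound \<open>x \<in> V\<close> by auto
  define M where "M = {y \<in> U. f y = Max (f ` U)}"
  have fin: "finite (f ` U)" "f ` U \<noteq> {}"
    using U(1) \<open>x \<in> U\<close> by auto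
  have c_less: "c < Max (f ` U)"
    using \<open>c < f x\<close> Max_ge[OF fin(1), of "f x"] \<open>x \<in> U\<close> by simp
  have le: "f y \<le> Max (f ` U)" if "y \<in> V" for y
    using that bound[of y] c_less fin(1) by (cases "y \<in> U") auto
  have "M \<subseteq> V" "V - M \<noteq> {}"
    using U unfolding M_def by auto
  moreover obtain z where "z \<in> M"
    using Max_in[OF fin] unfolding M_def by auto
  ultimately obtain p q where pq: "p \<in> M" "q \<in> V - M" "b p q \<noteq> 0"
    using exists_crossing_edge by blast
  have p: "p \<in> U" "p \<in> V" "f p = Max (f ` U)"
    using pq(1) U(2) unfolding M_def by auto
  have "\<forall>y\<in>neighbors V b p. (f p - f y) * b p y = 0"
    using harm[OF p(1)] p(2) le b_nonneg[OF p(2)] unfolding outflow_def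
    by (subst (asm) sum_nonneg_eq_0_iff) (auto simp: finite_neighbors[OF p(2)] p(3), auto simp: neighbors_def)
  then have "f q = Max (f ` U)"
    using pq p(3) unfolding neighbors_def by auto
  \<comment> \<open>For \<open>q\<close> in \<open>U\<close> this contradicts that \<open>q\<close>
    is not in \<open>M\<close>; outside \<open>U\<close> it contradicts the bound
    \<open>c\<close>.\<close>
  then show False
    using pq(2) bound[of q] c_less unfolding M_def by fastforce
qed

lemma minimum_principle:
  assumes "finite U" "U \<subseteq> V" "V - U \<noteq> {}"
    and "\<And>x. x \<in> U \<Longrightarrow> outflow f x = 0"
    and "\<And>x. x \<in> V - U \<Longrightarrow> c \<le> f x"
    and "x \<in> V"
  shows "c \<le> f x"
  using maximum_principle[of U "\<lambda>y. - f y" "- c" x] assms by (simp add: outflow_uminus)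

lemma harmonic_eq_0:
  assumes "finite U" "U \<subseteq> V" "V - U \<noteq> {}"
    and "\<And>x. x \<in> U \<Longrightarrow> outflow f x = 0"
    and "\<And>x. x \<in> V - U \<Longrightarrow> f x = 0"
    and "x \<in> V"
  shows "f x = 0"
proof (rule antisym)
  show "f x \<le> 0" by (rule maximum_principle[of U]) (use assms in auto)
  show "0 \<le> f x" by (rule minimum_principle[of U]) (use assms in auto)
qed

text \<open>Elimination of one vertex: if \<open>h\<close> and \<open>w\<close> solve the problem on \<open>U\<close> for the data \<open>g\<close> and for
  the indicator of a further vertex \<open>u\<close>, then some \<open>h + t w\<close> solves it on \<open>insert u U\<close>.  The
  coefficient of \<open>t\<close> in the equation at \<open>u\<close> is nonzero by uniqueness.\<close>

lemma dirichlet_problem_solvable: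
  assumes "finite U" "U \<subseteq> V" "V - U \<noteq> {}"
  shows "\<exists>f. (\<forall>x\<in>U. outflow f x = 0) \<and> (\<forall>x. x \<notin> U \<longrightarrow> f x = g x)"
  using assms
proof (induction U arbitrary: g rule: finite_induct)
  case empty
  then show ?case by blast
next
  case (insert u U)
  have IH: "\<exists>f. (\<forall>x\<in>U. outflow f x = 0) \<and> (\<forall>x. x \<notin> U \<longrightarrow> f x = g x)" for g
    using insert by blast
  obtain h where h: "\<And>x. x \<in> U \<Longrightarrow> outflow h x = 0" "\<And>x. x \<notin> U \<Longrightarrow> h x = g x"
    using IH[of g] by blast
  obtain w where w: "\<And>x. x \<in> U \<Longrightarrow> outflow w x = 0"
      "\<And>x. x \<notin> U \<Longrightarrow> w x = (if x = u then 1 else 0)"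
    using IH[of "\<lambda>x. if x = u then 1 else 0"] by blast
  have "outflow w u \<noteq> 0"
  proof
    assume "outflow w u = 0"
    have "w u = 0"
      by (rule harmonic_eq_0[of "insert u U"]) (use insert.prems insert.hyps(1) w \<open>outflow w u = 0\<close> in auto)
    then show False
      using w(2)[of u] insert.hyps(2) by simp
  qed
  define t where "t = - outflow h u / outflow w u"
  show ?case
  proof (intro exI[of _ "\<lambda>x. h x + t * w x"] conjI ballI allI impI)
    show "outflow (\<lambda>x. h x + t * w x) x = 0" if "x \<in> insert u U" for x
      using that h(1) w(1) \<open>outflow w u \<noteq> 0\<close> unfolding outflow_linear by (auto simp: t_def)
    show "h x + t * w x = g x" if "x \<notin> insert u U" for x
      using that h(2) w(2) by simp
  qed
qed

text \<open>The definite description is justified by treating \<open>a\<close> as a boundary vertex: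
  this is the Dirichlet problem on \<open>K - {a}\<close> with data \<open>1\<close> at
  \<open>a\<close> and \<open>0\<close> elsewhere.\<close>

lemma capacity_potential:
  fixes K :: "'v set" and a :: 'v
  assumes K: "finite K" "K \<subseteq> V" "V - K \<noteq> {}" and "a \<in> K"
  defines "v \<equiv> capacity_potential V b m K a"
  shows "\<And>x. x \<in> K - {a} \<Longrightarrow> outflow v x = 0" "v a = 1" "\<And>x. x \<notin> K \<Longrightarrow> v x = 0"
proof -
  let ?P = "\<lambda>v. (\<forall>x\<in>K - {a}. laplacian V b m v x = 0) \<and> v a = 1 \<and> (\<forall>x. x \<notin> K \<longrightarrow> v x = 0)"
  have U: "finite (K - {a})" "K - {a} \<subseteq> V" "V - (K - {a}) \<noteq> {}"
    using K by auto
  have harm: "(\<forall>x\<in>K - {a}. laplacian V b m f x = 0) \<longleftrightarrow> (\<forall>x\<in>K - {a}. outflow f x = 0)" for f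
    using K(2) laplacian_eq_0_iff by blast
  obtain f where f: "\<forall>x\<in>K - {a}. outflow f x = 0" "\<And>x. x \<notin> K - {a} \<Longrightarrow> f x = (if x = a then 1 else 0)"
    using dirichlet_problem_solvable[OF U, of "\<lambda>x. if x = a then 1 else 0"] by blast
  have Pf: "?P f"
    using f \<open>a \<in> K\<close> by (auto simp: harm)
  have "g = f" if "?P g" for g
  proof
    fix x
    have g: "\<forall>x\<in>K - {a}. outflow g x = 0" "g a = 1" "\<And>x. x \<notin> K \<Longrightarrow> g x = 0"
      using that harm by auto
    show "g x = f x"
    \<comment> \<open>The uniqueness result speaks about \<open>V\<close> only; outside
      \<open>K\<close>, and so outside \<open>V\<close>, both functions are \<open>0\<close> by
      prescription.\<close>
    proof (cases "x \<in> K")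
      case True
      have "(\<lambda>x. g x - f x) x = 0"
        by (rule harmonic_eq_0[OF U]) (use g f True K(2) in \<open>auto simp: outflow_diff\<close>)
      then show ?thesis by simp
    next
      case False
      then show ?thesis using g(3) Pf by simp
    qed
  qed
  then have "?P v"
    unfolding v_def capacity_potential_def using Pf by (rule theI[where P = ?P, rotated])
  then show "\<And>x. x \<in> K - {a} \<Longrightarrow> outflow v x = 0" "v a = 1" "\<And>x. x \<notin> K \<Longrightarrow> v x = 0"
    using harm by auto
qed

section \<open>Boundaries of finite sets\<close>

definition boundary_edges :: "'v set \<Rightarrow> ('v \<times> 'v) set" where
  "boundary_edges W = {(x, y) \<in> edge_boundary V W. b x y \<noteq> 0}"

text \<open>This form gives finiteness from local finiteness and turns an iterated sum into a sum
  over boundary edges.\<close>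

lemma boundary_edges_eq_Sigma:
  assumes "W \<subseteq> V"
  shows "boundary_edges W = (SIGMA x:W. neighbors V b x - W)"
  unfolding boundary_edges_def edge_boundary_def neighbors_def by auto

lemma finite_boundary_edges:
  assumes "finite W" "W \<subseteq> V"
  shows "finite (boundary_edges W)"
  using assms finite_neighbors by (auto simp: boundary_edges_eq_Sigma)

lemma boundary_weight_eq: "boundary_weight V b W = (\<Sum>(x, y)\<in>boundary_edges W. b x y)"
  unfolding boundary_weight_def boundary_edges_def ..

lemma boundary_edges_pos:
  assumes "W \<subseteq> V" "(x, y) \<in> boundary_edges W"
  shows "0 < b x y"
  using assms b_nonneg[of x y] unfolding boundary_edges_def edge_boundary_def by force

lemma boundary_weight_nonneg: "W \<subseteq> V \<Longrightarrow> 0 \<le> boundary_weight V b W"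
  unfolding boundary_weight_eq by (rule sum_nonneg) (auto dest: boundary_edges_pos)

lemma boundary_edges_nonempty:
  assumes "W \<subseteq> V" "W \<noteq> {}" "V - W \<noteq> {}"
  shows "boundary_edges W \<noteq> {}"
  using exists_crossing_edge[of W] assms unfolding boundary_edges_def edge_boundary_def by blast

lemma boundary_weight_pos:
  assumes "finite W" "W \<subseteq> V" "W \<noteq> {}" "V - W \<noteq> {}"
  shows "0 < boundary_weight V b W"
  unfolding boundary_weight_eq
  by (rule sum_pos)
    (use assms boundary_edges_nonempty finite_boundary_edges in \<open>auto dest: boundary_edges_pos\<close>)

text \<open>The boundary is an infinite set of pairs when \<open>V\<close> is infinite, but only finitely many of the
  weights on it differ from \<open>0\<close>, so that \<open>Max\<close> is meaningful.\<close>

lemma finite_boundary_values: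
  assumes "finite W" "W \<subseteq> V"
  shows "finite ((\<lambda>(x, y). b x y) ` edge_boundary V W)"
proof (rule finite_subset)
  show "(\<lambda>(x, y). b x y) ` edge_boundary V W \<subseteq> insert 0 ((\<lambda>(x, y). b x y) ` boundary_edges W)"
    unfolding boundary_edges_def by force
qed (use assms finite_boundary_edges in simp)

text \<open>A sum of nonnegative terms lies between its largest term and that term times the number
  of summands. This links conditions (ii) and (iii).\<close>

lemma Max_boundary_nonneg_le:
  assumes W: "finite W" "W \<subseteq> V" "W \<noteq> {}" "V - W \<noteq> {}"
  defines "M \<equiv> Max ((\<lambda>(x, y). b x y) ` edge_boundary V W)"
  shows "0 \<le> M" "M \<le> boundary_weight V b W"
    "boundary_weight V b W \<le> of_nat (card (boundary_edges W)) * M"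
proof -
  have fin: "finite ((\<lambda>(x, y). b x y) ` edge_boundary V W)"
    using finite_boundary_values W by blast
  have le_M: "b x y \<le> M" if "(x, y) \<in> edge_boundary V W" for x y
    unfolding M_def by (rule Max_ge[OF fin]) (use that in force)
  have "edge_boundary V W \<noteq> {}"
    using W(3,4) unfolding edge_boundary_def by blast
  then obtain p q where pq: "(p, q) \<in> edge_boundary V W"
    by fastforce
  have "0 \<le> b p q"
    using pq W(2) b_nonneg unfolding edge_boundary_def by auto
  with le_M[OF pq] show "0 \<le> M"
    by simp
  show "M \<le> boundary_weight V b W"
    unfolding M_def
  proof (rule Max.boundedI[OF fin])
    show "(\<lambda>(x, y). b x y) ` edge_boundary V W \<noteq> {}"
      using pq by blast
    fix t assume "t \<in> (\<lambda>(x, y). b x y) ` edge_boundary V W"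
    then obtain x y where xy: "(x, y) \<in> edge_boundary V W" "t = b x y"
      by auto
    show "t \<le> boundary_weight V b W"
    proof (cases "t = 0")
      case True
      then show ?thesis using boundary_weight_nonneg[OF W(2)] by simp
    next
      case False
      then have "(x, y) \<in> boundary_edges W"
        using xy unfolding boundary_edges_def by simp
      then show ?thesis
        using member_le_sum[of "(x, y)" "boundary_edges W" "\<lambda>(x, y). b x y"] xy(2)
          finite_boundary_edges[OF W(1,2)] boundary_edges_pos[OF W(2)]
        by (fastforce simp: boundary_weight_eq intro: less_imp_le)
    qed
  qed
  show "boundary_weight V b W \<le> of_nat (card (boundary_edges W)) * M"
    unfolding boundary_weight_eq
    by (rule sum_bounded_above) (use le_M in \<open>auto simp: boundary_edges_def\<close>)
qed

text \<open>A discrete divergence theorem: \<open>(f x - f y) * b x y\<close> is antisymmetric, so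
  inner edges cancel and only the boundary remains.\<close>

lemma sum_outflow_eq_flux:
  assumes "finite W" "W \<subseteq> V"
  shows "(\<Sum>x\<in>W. outflow f x) = (\<Sum>(x, y)\<in>boundary_edges W. (f x - f y) * b x y)"
proof -
  let ?g = "\<lambda>x y. (f x - f y) * b x y"
  have "outflow f x = (\<Sum>y\<in>W. ?g x y) + (\<Sum>y\<in>neighbors V b x - W. ?g x y)" if "x \<in> W" for x
  proof -
    have "x \<in> V" using that assms(2) by blast
    have "outflow f x = sum (?g x) (neighbors V b x \<inter> W) + sum (?g x) (neighbors V b x - W)"
      unfolding outflow_def using finite_neighbors[OF \<open>x \<in> V\<close>] by (rule sum.Int_Diff)
    \<comment> \<open>The added pairs have weight \<open>0\<close>; the index set becomes the
      symmetric square of \<open>W\<close>.\<close>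
    also have "sum (?g x) (neighbors V b x \<inter> W) = sum (?g x) W"
      by (rule sum.mono_neutral_left) (use assms in \<open>auto simp: neighbors_def\<close>)
    finally show ?thesis .
  qed
  then have "(\<Sum>x\<in>W. outflow f x) =
      (\<Sum>x\<in>W. \<Sum>y\<in>W. ?g x y) + (\<Sum>x\<in>W. \<Sum>y\<in>neighbors V b x - W. ?g x y)"
    by (simp add: sum.distrib)
  moreover have "(\<Sum>x\<in>W. \<Sum>y\<in>W. ?g x y) = - (\<Sum>x\<in>W. \<Sum>y\<in>W. ?g x y)"
  proof -
    have "(\<Sum>x\<in>W. \<Sum>y\<in>W. ?g x y) = (\<Sum>y\<in>W. \<Sum>x\<in>W. ?g x y)"
      by (rule sum.swap)
    also have "\<dots> = (\<Sum>y\<in>W. \<Sum>x\<in>W. - ?g y x)"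
    proof (intro sum.cong refl)
      fix x y assume "x \<in> W" "y \<in> W"
      then have "b x y = b y x" using b_sym assms(2) by blast
      then show "?g x y = - ?g y x" by (simp add: algebra_simps)
    qed
    finally show ?thesis by (simp add: sum_negf)
  qed
  moreover have "(\<Sum>x\<in>W. \<Sum>y\<in>neighbors V b x - W. ?g x y) = (\<Sum>(x, y)\<in>boundary_edges W. ?g x y)"
    unfolding boundary_edges_eq_Sigma[OF assms(2)]
    by (rule sum.Sigma) (use assms finite_neighbors in auto)
  ultimately show ?thesis by simp
qed

text \<open>\<open>W\<close> may be any set between \<open>{a}\<close> and \<open>K\<close>, so that
  one fixed ball bounds the capacities of all larger ones.\<close>

lemma capacity_bounds:
  assumes K: "finite K" "K \<subseteq> V" "V - K \<noteq> {}" and W: "a \<in> W" "W \<subseteq> K"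
  shows "0 \<le> capacity V b m K a" "capacity V b m K a \<le> boundary_weight V b W"
proof -
  define v where "v = capacity_potential V b m K a"
  have "a \<in> K" "a \<in> V"
    using W K by auto
  have fin_W: "finite W" "W \<subseteq> V"
    using W K finite_subset by auto
  note v = capacity_potential[OF K \<open>a \<in> K\<close>, folded v_def]
  have U: "finite (K - {a})" "K - {a} \<subseteq> V" "V - (K - {a}) \<noteq> {}"
    using K by auto
  have off: "v x = 1 \<or> v x = 0" if "x \<in> V - (K - {a})" for x
    using that v(2) v(3)[of x] by auto
  have le: "v x \<le> 1" if "x \<in> V" for x
    by (rule maximum_principle[OF U v(1) _ that]) (use off in force)+
  have ge: "0 \<le> v x" if "x \<in> V" for x
    by (rule minimum_principle[OF U v(1) _ that]) (use off in force)+
  have cap: "capacity V b m K a = outflow v a"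
    using m_pos[OF \<open>a \<in> V\<close>] unfolding capacity_def v_def[symmetric] laplacian_eq_outflow by simp
  show "0 \<le> capacity V b m K a"
    unfolding cap outflow_def
    by (rule sum_nonneg) (use le v(2) b_nonneg \<open>a \<in> V\<close> in \<open>auto simp: neighbors_def\<close>)
  \<comment> \<open>All other vertices of \<open>W\<close> lie in \<open>K - {a}\<close>, where
    \<open>v\<close> is harmonic.\<close>
  have "outflow v a = (\<Sum>x\<in>W. outflow v x)"
    using fin_W(1) W v(1) by (subst sum.remove[of W a]) (auto intro!: sum.neutral)
  also have "\<dots> = (\<Sum>(x, y)\<in>boundary_edges W. (v x - v y) * b x y)"
    by (rule sum_outflow_eq_flux[OF fin_W])
  also have "\<dots> \<le> boundary_weight V b W"
    unfolding boundary_weight_eq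
  proof (rule sum_mono, clarify)
    fix x y
    assume xy: "(x, y) \<in> boundary_edges W"
    then have "x \<in> V" "y \<in> V"
      using fin_W(2) unfolding boundary_edges_def edge_boundary_def by auto
    then have "(v x - v y) * b x y \<le> 1 * b x y"
      using le[of x] ge[of y] b_nonneg by (intro mult_right_mono) auto
    then show "(v x - v y) * b x y \<le> b x y" by simp
  qed
  finally show "capacity V b m K a \<le> boundary_weight V b W"
    unfolding cap .
qed

section \<open>Balls\<close>

lemma graph_ball_subset: "graph_ball V b a n \<subseteq> V"
  unfolding graph_ball_def by blast

lemma graph_ball_mono: "n \<le> n' \<Longrightarrow> graph_ball V b a n \<subseteq> graph_ball V b a n'"
  unfolding graph_ball_def by auto

text \<open>The path of length \<open>0\<close> puts \<open>a\<close> at distance \<open>0\<close>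
  from itself. The ball of radius \<open>0\<close> is empty, hence the bound on
  \<open>n\<close>.\<close>

lemma center_in_graph_ball: "a \<in> V \<Longrightarrow> 1 \<le> n \<Longrightarrow> a \<in> graph_ball V b a n"
  unfolding graph_ball_def graph_dist_def
  by (auto intro: le_less_trans[OF Least_le[of _ 0]])

lemma finite_graph_ball:
  assumes "a \<in> V"
  shows "finite (graph_ball V b a n)"
proof -
  have "finite {x. (a, x) \<in> adjacency V b ^^ k}" for k
  proof (induction k)
    case 0
    then show ?case by simp
  next
    case (Suc k)
    have "{x. (a, x) \<in> adjacency V b ^^ Suc k} \<subseteq>
        (\<Union>x\<in>{x. (a, x) \<in> adjacency V b ^^ k} \<inter> V. neighbors V b x)"
      unfolding neighbors_def adjacency_def by auto
    then show ?case
      by (rule finite_subset) (use Suc finite_neighbors in blast)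
  qed
  moreover have "graph_ball V b a n \<subseteq> (\<Union>k<n. {x. (a, x) \<in> adjacency V b ^^ k})"
  proof
    fix x assume x: "x \<in> graph_ball V b a n"
    then have "\<exists>k. (a, x) \<in> adjacency V b ^^ k"
      using connected assms unfolding connected_graph_def graph_ball_def by blast
    \<comment> \<open>Connectedness makes the \<open>LEAST\<close> in the distance the length of an
      actual path.\<close>
    then have "(a, x) \<in> adjacency V b ^^ graph_dist V b a x"
      unfolding graph_dist_def by (rule LeastI_ex)
    then show "x \<in> (\<Union>k<n. {x. (a, x) \<in> adjacency V b ^^ k})"
      using x unfolding graph_ball_def by auto
  qed
  ultimately show ?thesis
    by (meson finite_UN_I finite_lessThan finite_subset)
qed

text \<open>A subsequence controls the full sequence of capacities: once one ball has small boundary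
  weight, every larger ball has small capacity.\<close>

lemma null_capacity_if_null_subsequence:
  assumes "infinite V" "a \<in> V" and n: "\<And>k. 1 \<le> n k"
    and lim: "converges_to (\<lambda>k. boundary_weight V b (graph_ball V b a (n k))) 0"
  shows "null_capacity V b m"
proof -
  let ?B = "graph_ball V b a"
  have "converges_to (\<lambda>N. capacity V b m (?B N) a) 0"
    unfolding converges_to_def
  proof (intro allI impI)
    fix c :: 'k
    assume "0 < c"
    then have "\<forall>\<^sub>F k in sequentially. \<bar>boundary_weight V b (?B (n k))\<bar> \<le> c"
      using lim unfolding converges_to_def by simp
    then obtain k where k: "\<bar>boundary_weight V b (?B (n k))\<bar> \<le> c"
      unfolding eventually_sequentially by blast
    have "\<bar>capacity V b m (?B N) a - 0\<bar> \<le> c" if "n k \<le> N" for N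
    proof -
      have "V - ?B N \<noteq> {}"
        using assms(1) finite_graph_ball[OF assms(2), of N] by (auto dest: finite_subset)
      then have "0 \<le> capacity V b m (?B N) a"
        "capacity V b m (?B N) a \<le> boundary_weight V b (?B (n k))"
        using capacity_bounds[OF finite_graph_ball[OF assms(2)] graph_ball_subset, of N a "?B (n k)"]
          center_in_graph_ball[OF assms(2) n] graph_ball_mono[OF that] by blast+
      then show ?thesis
        using k by simp
    qed
    then show "\<forall>\<^sub>F N in sequentially. \<bar>capacity V b m (?B N) a - 0\<bar> \<le> c"
      unfolding eventually_sequentially by blast
  qed
  with assms(2) show ?thesis
    unfolding null_capacity_def by blast
qed

end

section \<open>Equivalence of the three conditions and null capacity\<close>

theorem theorem5p3:
  fixes V :: "'v set"
    and b :: "'v \<Rightarrow> 'v \<Rightarrow> 'k::linordered_field"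
    and m :: "'v \<Rightarrow> 'k"
    and a :: 'v
  defines "cond_i \<equiv>
      filterlim (\<lambda>N::nat. \<Sum>r=1..N. 1 / boundary_weight V b (graph_ball V b a r)) at_top sequentially"
    and "cond_ii \<equiv>
      (\<exists>n::nat \<Rightarrow> nat. strict_mono n \<and> (\<forall>k. 1 \<le> n k) \<and>
        converges_to (\<lambda>k. boundary_weight V b (graph_ball V b a (n k))) 0)"
    and "cond_iii \<equiv>
      (\<exists>n::nat \<Rightarrow> nat. strict_mono n \<and> (\<forall>k. 1 \<le> n k) \<and>
        converges_to (\<lambda>k. Max ((\<lambda>(x, y). b x y) ` edge_boundary V (graph_ball V b a (n k)))) 0)"
  assumes "non_archimedean TYPE('k)"
    and "cauchy_complete TYPE('k)"
    and "countable_cofinality TYPE('k)"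
    and "weighted_graph V b m"
    and "infinite V"
    and "locally_finite_graph V b"
    and "connected_graph V b"
    and "a \<in> V"
  shows "(cond_i \<longleftrightarrow> cond_ii) \<and> (cond_ii \<longleftrightarrow> cond_iii) \<and>
    (cond_i \<or> cond_ii \<or> cond_iii \<longrightarrow> null_capacity V b m)"
proof -
  interpret locally_finite_connected_graph V b m
    using assms(7,9,10)
    by (intro locally_finite_connected_graph.intro locally_finite_connected_graph_axioms.intro)
  let ?B = "graph_ball V b a"
  let ?w = "\<lambda>r. boundary_weight V b (?B r)"
  let ?M = "\<lambda>r. Max ((\<lambda>(x, y). b x y) ` edge_boundary V (?B r))"
  have ball: "finite (?B r)" "?B r \<subseteq> V" "V - ?B r \<noteq> {}" for r
    using finite_graph_ball[OF \<open>a \<in> V\<close>, of r] graph_ball_subset[of a r] \<open>infinite V\<close>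
    by (auto dest: finite_subset)
  have ball_ne: "?B r \<noteq> {}" if "1 \<le> r" for r
    using center_in_graph_ball[OF \<open>a \<in> V\<close> that] by blast
  have w_pos: "0 < ?w r" if "1 \<le> r" for r
    using boundary_weight_pos[OF ball(1,2) ball_ne[OF that] ball(3)] .
  note M = Max_boundary_nonneg_le[OF ball(1,2) ball_ne ball(3)]
  obtain T :: 'k where T: "0 < T" "\<And>n::nat. of_nat n \<le> T"
    using non_archimedean_bound[OF assms(4)] by blast
  \<comment> \<open>The number of boundary edges may grow with \<open>r\<close>, but
    \<open>T\<close> bounds it uniformly.\<close>
  have w_le: "?w r \<le> T * ?M r" if "1 \<le> r" for r
    using M(3)[OF that] mult_right_mono[OF T(2) M(1)[OF that]] by (rule order_trans)
  have i_ii: "cond_ii" if cond_i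
    unfolding cond_ii_def
  proof (rule null_subsequence[OF assms(6)])
    \<comment> \<open>This includes \<open>r = 0\<close>, where the ball is empty and the weight is
      \<open>0\<close>.\<close>
    show "0 \<le> ?w r" for r
      using boundary_weight_nonneg ball(2) .
    show "\<exists>r\<ge>N. ?w r \<le> c" if "0 < c" for c N
      by (rule small_if_reciprocals_diverge[OF assms(4)])
        (use \<open>cond_i\<close> that in \<open>auto simp: cond_i_def\<close>)
  qed
  have ii_i: "cond_i" if cond_ii
    using that reciprocals_diverge_if_null_subsequence[of ?w] w_pos
    unfolding cond_i_def cond_ii_def by blast
  have ii_iii: "cond_iii" if cond_ii
  proof -
    from that obtain n where n: "strict_mono n" "\<forall>k. 1 \<le> n k" "converges_to (\<lambda>k. ?w (n k)) 0"
      unfolding cond_ii_def by blast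
    have "converges_to (\<lambda>k. ?M (n k)) 0"
      using n(3)
    proof (rule converges_to_zero_mono)
      show "\<bar>?M (n k)\<bar> \<le> \<bar>?w (n k)\<bar>" for k
        using M(1,2)[of "n k"] n(2) by simp
    qed
    with n show ?thesis
      unfolding cond_iii_def by blast
  qed
  have iii_ii: "cond_ii" if cond_iii
  proof -
    from that obtain n where n: "strict_mono n" "\<forall>k. 1 \<le> n k" "converges_to (\<lambda>k. ?M (n k)) 0"
      unfolding cond_iii_def by blast
    have "converges_to (\<lambda>k. ?w (n k)) 0"
      using converges_to_zero_mult[OF n(3) T(1)]
    proof (rule converges_to_zero_mono)
      show "\<bar>?w (n k)\<bar> \<le> \<bar>T * ?M (n k)\<bar>" for k
        using w_le[of "n k"] w_pos[of "n k"] n(2) by simp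
    qed
    with n show ?thesis
      unfolding cond_ii_def by blast
  qed
  have "null_capacity V b m" if cond_ii
    using that null_capacity_if_null_subsequence[OF \<open>infinite V\<close> \<open>a \<in> V\<close>]
    unfolding cond_ii_def by blast
  with i_ii ii_i ii_iii iii_ii show ?thesis
    by blast
qed

end
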